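(* Let $n\ge 3$, let $P_n(R)$ be a regular $n$-gon in the Euclidean plane with vertices $A_1,\dots,A_n$, circumradius $R>0$ and centroid $O$. Let $M$ be an arbitrary point of the plane, let $d_i=|MA_i|$ for $i=1,\dots,n$ and $L=|MO|$. Then for every $m=1,\dots,n-1$, $$\sum_{i=1}^n d_i^{2m}=n\left[(R^2+L^2)^m+\sum_{k=1}^{\lfloor m/2\rfloor}\binom{m}{2k}\binom{2k}{k}R^{2k}L^{2k}(R^2+L^2)^{m-2k}\right].$$
   Context: $|XY|$ denotes Euclidean distance; an empty sum is $0$. *)

theory Defs
  imports "HOL-Analysis.Analysis"
begin

(* The Euclidean plane is the type complex, whose dist, norm and inner product are the Euclidean
   ones.  A polygon with n vertices is given by its vertices A 1, ..., A n in cyclic order;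
   the vertex after A i is A (i mod n + 1), so A 1 follows A n. *)

definition succ_vertex :: "nat \<Rightarrow> (nat \<Rightarrow> complex) \<Rightarrow> nat \<Rightarrow> complex" where
  "succ_vertex n A i = A (i mod n + 1)"

(* The edge condition makes A 1, ..., A n a traversal of the boundary of the hull.  The end points
   of an edge are extreme points, so no vertex lies in the interior of a side; injectivity
   excludes going round the boundary several times. *)

definition convex_polygon :: "nat \<Rightarrow> (nat \<Rightarrow> complex) \<Rightarrow> bool" where
  "convex_polygon n A \<longleftrightarrow> inj_on A {1..n} \<and>
     (\<forall>i\<in>{1..n}. closed_segment (A i) (succ_vertex n A i) edge_of (convex hull (A ` {1..n})))"

(* Unsigned angle at Y, in [0, pi]; this is the interior angle at a vertex of a convex polygon. *)

definition angle_at :: "complex \<Rightarrow> complex \<Rightarrow> complex \<Rightarrow> real" where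
  "angle_at X Y Z = arccos (((X - Y) \<bullet> (Z - Y)) / (norm (X - Y) * norm (Z - Y)))"

definition regular_polygon :: "nat \<Rightarrow> (nat \<Rightarrow> complex) \<Rightarrow> bool" where
  "regular_polygon n A \<longleftrightarrow> convex_polygon n A \<and>
     (\<exists>s. \<forall>i\<in>{1..n}. dist (A i) (succ_vertex n A i) = s) \<and>
     (\<exists>\<alpha>. \<forall>i\<in>{1..n}. angle_at (A i) (succ_vertex n A i) (succ_vertex n A (i mod n + 1)) = \<alpha>)"

definition has_circumradius :: "nat \<Rightarrow> (nat \<Rightarrow> complex) \<Rightarrow> real \<Rightarrow> bool" where
  "has_circumradius n A R \<longleftrightarrow> (\<exists>C. \<forall>i\<in>{1..n}. dist C (A i) = R)"

definition vertex_centroid :: "nat \<Rightarrow> (nat \<Rightarrow> complex) \<Rightarrow> complex" where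
  "vertex_centroid n A = (\<Sum>i=1..n. A i) /\<^sub>R real n"

end

theory Submission
  imports Defs
begin

text \<open>Equal sides on a circle mean that consecutive vertices, seen from the circumcentre, differ by a
  factor \<open>w\<close> or its conjugate; as \<open>A i\<close> and \<open>A (i + 2)\<close> are distinct, the same factor occurs at
  every step. So the vertices are \<open>C + z * w ^ i\<close>, where \<open>w\<close> is a root of unity of exact order
  \<open>n\<close>. With \<open>u = M - C\<close>, the squared
  distance is \<open>R\<^sup>2 + L\<^sup>2\<close> minus \<open>cnj u * b + u * cnj b\<close>, where \<open>b = z * w ^ i\<close>. Expanding its
  \<open>m\<close>-th power, orthogonality of the powers of \<open>w\<close> leaves only the monomials that contain \<open>b\<close>
  and \<open>cnj b\<close> equally often, because \<open>m < n\<close>.\<close>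

text \<open>As distinct points of the circle at equal distance from \<open>y\<close>,
  \<open>x\<close> and \<open>z\<close> are mirror images in the line through 0 and
  \<open>y\<close>, so the rotation from \<open>x\<close> to \<open>y\<close> also takes
  \<open>y\<close> to \<open>z\<close>.\<close>

lemma equal_chords_on_circle:
  fixes x y z :: complex
  assumes "norm x = R" "norm y = R" "norm z = R" "R > 0"
    and "dist x y = dist y z" "x \<noteq> z"
  shows "x * z = y\<^sup>2"
proof -
  have nz: "y \<noteq> 0" "x \<noteq> 0" using assms by auto
  have cn: "t * cnj t = of_real (R\<^sup>2)" if "norm t = R" for t
    using that complex_norm_square[of t] by simp
  have "(x - y) * cnj (x - y) = (z - y) * cnj (z - y)"
    using assms(5) by (metis complex_norm_square dist_commute dist_norm)
  hence "x * cnj y + y * cnj x = z * cnj y + y * cnj z"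
    using cn[OF assms(1)] cn[OF assms(2)] cn[OF assms(3)] by (simp add: algebra_simps)
  \<comment> \<open>The factor \<open>x * y * z\<close> pairs every conjugate with its own variable,
    so each \<open>t * cnj t\<close> becomes R^2 and only a polynomial that factors is left.\<close>
  hence "(x * cnj y + y * cnj x) * (x * y * z) = (z * cnj y + y * cnj z) * (x * y * z)"
    by simp
  hence "x\<^sup>2 * z * (y * cnj y) + y\<^sup>2 * z * (x * cnj x) = z\<^sup>2 * x * (y * cnj y) + y\<^sup>2 * x * (z * cnj z)"
    by (simp add: algebra_simps power2_eq_square)
  hence "of_real (R\<^sup>2) * ((x - z) * (x * z - y\<^sup>2)) = 0"
    using cn[OF assms(1)] cn[OF assms(2)] cn[OF assms(3)]
    by (simp add: algebra_simps power2_eq_square)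
  thus ?thesis using assms by simp
qed

lemma geometric_of_equal_chords:
  fixes B :: "nat \<Rightarrow> complex"
  assumes "\<And>i. norm (B i) = R" "R > 0" "\<And>i. dist (B i) (B (Suc i)) = s"
    and "\<And>i. B i \<noteq> B (Suc (Suc i))"
  shows "B i = B 0 * (B 1 / B 0) ^ i"
proof -
  have nz: "B i \<noteq> 0" for i using assms(1)[of i] assms(2) by auto
  have step: "B (Suc i) = B i * (B 1 / B 0)" for i
  proof (induction i)
    case 0
    show ?case using nz by simp
  next
    case (Suc i)
    have "B i * B (Suc (Suc i)) = (B (Suc i))\<^sup>2"
      by (rule equal_chords_on_circle[of _ R]) (use assms in auto)
    hence "B (Suc (Suc i)) = B (Suc i) * (B (Suc i) / B i)"
      using nz[of i] by (simp add: field_simps power2_eq_square)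
    thus ?case using Suc nz[of i] by simp
  qed
  show ?thesis
  proof (induction i)
    case (Suc i)
    show ?case by (simp only: step[of i] Suc power_Suc2 mult.assoc)
  qed simp
qed

lemma sum_powers_root_of_unity:
  fixes v :: "'a :: field"
  assumes "v ^ n = 1"
  shows "(\<Sum>i<n. v ^ i) = (if v = 1 then of_nat n else 0)"
  using assms by (simp add: sum_gp_strict)

text \<open>In the binomial expansion the term with index \<open>l\<close> varies with
  \<open>i\<close> as w^((2 l - j) i). Since |2 l - j| \<le> j < n, its sum over \<open>i\<close>
  vanishes unless 2 l = j, and only the central binomial coefficient survives. Writing
  \<open>inverse\<close> instead of a conjugate keeps the computation valid in any field.\<close>

lemma sum_binomial_root_of_unity:
  fixes p q a w :: "'a :: field"
  assumes w: "w ^ n = 1" "inj_on (\<lambda>i. w ^ i) {..<n}" and a: "a \<noteq> 0" and j: "j < n"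
  shows "(\<Sum>i<n. (p * (a * w ^ i) + q * inverse (a * w ^ i)) ^ j) =
    (if even j then of_nat n * of_nat (j choose (j div 2)) * (p * q) ^ (j div 2) else 0)"
proof -
  have w0: "w \<noteq> 0" using w(1) j by (auto simp: power_0_left)
  define c where "c l = of_nat (j choose l) * (p * a) ^ l * (q * inverse a) ^ (j - l)" for l
  have term_eq: "of_nat (j choose l) * (p * (a * w ^ i)) ^ l * (q * inverse (a * w ^ i)) ^ (j - l)
      = c l * (w ^ l * inverse w ^ (j - l)) ^ i" for i l
    unfolding c_def by (simp add: power_mult_distrib power_inverse flip: power_mult) (simp add: mult_ac)
  have inner: "(\<Sum>i<n. (w ^ l * inverse w ^ (j - l)) ^ i) = (if 2 * l = j then of_nat n else 0)"
    if "l \<le> j" for l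
  proof -
    have 1: "(w ^ l * inverse w ^ (j - l)) ^ n = (w ^ n) ^ l * inverse (w ^ n) ^ (j - l)"
      by (simp add: power_mult_distrib power_inverse mult_ac flip: power_mult)
    \<comment> \<open>With the inverse moved to the other side, both exponents lie below
      \<open>n\<close>, where the powers of \<open>w\<close> are distinct.\<close>
    have "w ^ l * inverse w ^ (j - l) = 1 \<longleftrightarrow> w ^ l = w ^ (j - l)"
      using w0 by (simp add: power_inverse divide_simps)
    also have "\<dots> \<longleftrightarrow> l = j - l"
      using inj_onD[OF w(2), of l "j - l"] that j by auto
    also have "\<dots> \<longleftrightarrow> 2 * l = j" using that by auto
    finally show ?thesis using sum_powers_root_of_unity[of "w ^ l * inverse w ^ (j - l)" n] 1 w(1)
      by simp
  qed
  have "(\<Sum>i<n. (p * (a * w ^ i) + q * inverse (a * w ^ i)) ^ j) =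
    (\<Sum>i<n. \<Sum>l\<le>j. c l * (w ^ l * inverse w ^ (j - l)) ^ i)"
    by (simp only: binomial_ring term_eq)
  also have "\<dots> = (\<Sum>l\<le>j. c l * (\<Sum>i<n. (w ^ l * inverse w ^ (j - l)) ^ i))"
    by (subst sum.swap) (simp add: sum_distrib_left)
  also have "\<dots> = (\<Sum>l\<le>j. if 2 * l = j then c l * of_nat n else 0)"
    by (rule sum.cong) (auto simp: inner)
  also have "\<dots> = (if even j then c (j div 2) * of_nat n else 0)"
  proof (cases "even j")
    case True
    hence "(\<Sum>l\<le>j. if 2 * l = j then c l * of_nat n else 0) =
        (\<Sum>l\<le>j. if l = j div 2 then c l * of_nat n else 0)"
      by (intro sum.cong) auto
    thus ?thesis using True by simp
  next
    case False
    thus ?thesis by (auto intro!: sum.neutral)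
  qed
  also have "\<dots> = (if even j then of_nat n * of_nat (j choose (j div 2)) * (p * q) ^ (j div 2) else 0)"
  proof (cases "even j")
    case True
    then obtain k where "j = 2 * k" by auto
    thus ?thesis using a by (simp add: c_def power_mult_distrib field_simps)
  qed simp
  finally show ?thesis .
qed

lemma sum_even_index:
  fixes f :: "nat \<Rightarrow> 'a :: comm_monoid_add"
  shows "(\<Sum>j\<le>m. if even j then f j else 0) = (\<Sum>k\<le>m div 2. f (2 * k))"
proof -
  have "(\<Sum>j\<le>m. if even j then f j else 0) = (\<Sum>j\<in>{j. j \<le> m \<and> even j}. f j)"
    by (rule sum.mono_neutral_cong_right) auto
  also have "\<dots> = (\<Sum>k\<le>m div 2. f (2 * k))"
    by (rule sum.reindex_bij_witness[of _ "\<lambda>k. 2 * k" "\<lambda>j. j div 2"]) auto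
  finally show ?thesis .
qed

text \<open>Expanding in powers of \<open>S\<close> reduces this to the unshifted sums with exponent
  \<open>j\<close> \<le> \<open>m\<close>, of which the odd ones vanish.\<close>

lemma sum_shifted_binomial_root_of_unity:
  fixes p q a w S :: "'a :: field"
  assumes w: "w ^ n = 1" "inj_on (\<lambda>i. w ^ i) {..<n}" and a: "a \<noteq> 0" and m: "m < n"
  shows "(\<Sum>i<n. (p * (a * w ^ i) + q * inverse (a * w ^ i) + S) ^ m) =
    of_nat n * (\<Sum>k\<le>m div 2. of_nat (m choose (2 * k)) * of_nat ((2 * k) choose k) *
      (p * q) ^ k * S ^ (m - 2 * k))"
proof -
  define X where "X i = p * (a * w ^ i) + q * inverse (a * w ^ i)" for i
  have "(\<Sum>i<n. (X i + S) ^ m) = (\<Sum>i<n. \<Sum>j\<le>m. of_nat (m choose j) * X i ^ j * S ^ (m - j))"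
    by (simp add: binomial_ring)
  also have "\<dots> = (\<Sum>j\<le>m. of_nat (m choose j) * S ^ (m - j) * (\<Sum>i<n. X i ^ j))"
    by (subst sum.swap) (simp add: sum_distrib_left mult_ac)
  also have "\<dots> = (\<Sum>j\<le>m. if even j then of_nat (m choose j) * S ^ (m - j) *
      (of_nat n * of_nat (j choose (j div 2)) * (p * q) ^ (j div 2)) else 0)"
  proof (rule sum.cong)
    fix j assume "j \<in> {..m}"
    hence "j < n" using m by simp
    from sum_binomial_root_of_unity[OF w a this, of p q, folded X_def]
    show "of_nat (m choose j) * S ^ (m - j) * (\<Sum>i<n. X i ^ j) =
        (if even j then of_nat (m choose j) * S ^ (m - j) *
          (of_nat n * of_nat (j choose (j div 2)) * (p * q) ^ (j div 2)) else 0)" by simp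
  qed simp
  also have "\<dots> = of_nat n * (\<Sum>k\<le>m div 2. of_nat (m choose (2 * k)) * of_nat ((2 * k) choose k) *
      (p * q) ^ k * S ^ (m - 2 * k))"
    by (subst sum_even_index) (simp add: sum_distrib_left mult_ac)
  finally show ?thesis unfolding X_def .
qed

lemma regular_polygon_vertices:
  assumes n: "n \<ge> 3" and reg: "regular_polygon n A"
    and C: "\<And>i. i \<in> {1..n} \<Longrightarrow> dist C (A i) = R" and R: "R > 0"
  obtains z w where "norm z = R" "norm w = 1" "w ^ n = 1" "inj_on (\<lambda>i. w ^ i) {..<n}"
    and "\<And>i. i < n \<Longrightarrow> A (Suc i) = C + z * w ^ i"
proof -
  \<comment> \<open>The vertices seen from \<open>C\<close>, numbered from 0 and continued
    periodically: the ratio argument then runs over all naturals, and \<open>B n = B 0\<close>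
    yields the root of unity.\<close>
  define B where "B i = A (Suc (i mod n)) - C" for i
  have inj: "inj_on A {1..n}" using reg by (simp add: regular_polygon_def convex_polygon_def)
  obtain s where s: "\<And>i. i \<in> {1..n} \<Longrightarrow> dist (A i) (succ_vertex n A i) = s"
    using reg by (auto simp: regular_polygon_def)
  have mem: "Suc (i mod n) \<in> {1..n}" for i using n by (simp add: Suc_leI)
  have norm_B: "norm (B i) = R" for i
    using C[OF mem[of i]] by (simp add: B_def dist_norm norm_minus_commute)
  have "dist (B i) (B (Suc i)) = s" for i
    using s[OF mem[of i]] by (simp add: B_def succ_vertex_def dist_norm mod_Suc_eq)
  moreover have B_eq: "B i = B j \<longleftrightarrow> i mod n = j mod n" for i j
    using inj_onD[OF inj _ mem[of i] mem[of j]] by (auto simp: B_def)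
  \<comment> \<open>Here \<open>n \<ge> 3\<close> matters: a step of two never returns to the same
    vertex.\<close>
  moreover have "i mod n \<noteq> Suc (Suc i) mod n" for i
    using n mod_less[of i n] mod_less_divisor[of n i] by (simp add: mod_Suc split: if_splits)
  ultimately have geo: "B i = B 0 * (B 1 / B 0) ^ i" for i
    using geometric_of_equal_chords[of B R s i] norm_B R by auto
  have nz: "B 0 \<noteq> 0" using norm_B[of 0] R by auto
  show ?thesis
  proof
    show "norm (B 0) = R" by (rule norm_B)
    show "norm (B 1 / B 0) = 1" using norm_B R by (simp add: norm_divide)
    show "(B 1 / B 0) ^ n = 1" using geo[of n] B_eq[of n 0] nz by simp
    show "inj_on (\<lambda>i. (B 1 / B 0) ^ i) {..<n}"
    proof (rule inj_onI)
      fix i j assume "i \<in> {..<n}" "j \<in> {..<n}" "(B 1 / B 0) ^ i = (B 1 / B 0) ^ j"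
      thus "i = j" using B_eq[of i j] geo[of i] geo[of j] by simp
    qed
    show "A (Suc i) = C + B 0 * (B 1 / B 0) ^ i" if "i < n" for i
      using geo[of i] that by (simp add: B_def algebra_simps)
  qed
qed

theorem theorem3p1:
  fixes n m :: nat and A :: "nat \<Rightarrow> complex" and M :: complex
    and d :: "nat \<Rightarrow> real" and R L :: real
  assumes "n \<ge> 3"
    and "regular_polygon n A"
    and "has_circumradius n A R" and "R > 0"
    and "\<And>i. i \<in> {1..n} \<Longrightarrow> d i = dist M (A i)"
    and "L = dist M (vertex_centroid n A)"
    and "m \<in> {1..n - 1}"
  shows "(\<Sum>i=1..n. d i ^ (2 * m)) =
    real n * ((R\<^sup>2 + L\<^sup>2) ^ m +
      (\<Sum>k=1..m div 2. real (m choose (2 * k)) * real ((2 * k) choose k) *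
         R ^ (2 * k) * L ^ (2 * k) * (R\<^sup>2 + L\<^sup>2) ^ (m - 2 * k)))"
proof -
  obtain C where "\<And>i. i \<in> {1..n} \<Longrightarrow> dist C (A i) = R"
    using assms(3) unfolding has_circumradius_def by blast
  then obtain z w where z: "norm z = R" and w: "norm w = 1" "w ^ n = 1" "inj_on (\<lambda>i. w ^ i) {..<n}"
    and A: "\<And>i. i < n \<Longrightarrow> A (Suc i) = C + z * w ^ i"
    using regular_polygon_vertices[OF assms(1,2) _ assms(4), of C] by metis
  have z0: "z \<noteq> 0" using z assms(4) by auto
  \<comment> \<open>The powers of \<open>w\<close> sum to 0, which identifies the circumcentre
    \<open>C\<close> with the centroid, so \<open>L\<close> is measured from
    \<open>C\<close>.\<close>
  have "w \<noteq> 1" using inj_onD[OF w(3), of 0 1] assms(1) by auto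
  hence "(\<Sum>i<n. w ^ i) = 0" using sum_powers_root_of_unity[OF w(2)] by simp
  hence "(\<Sum>i<n. A (Suc i)) = of_nat n * C"
    by (simp add: A sum.distrib flip: sum_distrib_left)
  hence "vertex_centroid n A = C"
    using assms(1) by (simp add: vertex_centroid_def sum.atLeast1_atMost_eq scaleR_conv_of_real)
  hence L: "L = norm (M - C)" using assms(6) by (simp add: dist_norm)
  define u where "u = M - C"
  have uu: "u * cnj u = of_real (L\<^sup>2)" using complex_norm_square[of u] by (simp add: L u_def)
  \<comment> \<open>On the circle \<open>cnj b\<close> is R^2 times \<open>inverse b\<close>;
    \<open>p\<close> and \<open>q\<close> are the resulting coefficients of \<open>b\<close> and
    \<open>inverse b\<close> in the squared distance.\<close>
  define p where "p = - cnj u"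
  define q where "q = - (u * of_real (R\<^sup>2))"
  define S where "S = complex_of_real (R\<^sup>2 + L\<^sup>2)"
  have dist_sq: "of_real ((d (Suc i))\<^sup>2) = p * (z * w ^ i) + q * inverse (z * w ^ i) + S"
    if i: "i < n" for i
  proof -
    define b where "b = z * w ^ i"
    have "norm b = R" using z w(1) by (simp add: b_def norm_mult norm_power)
    hence bb: "b * cnj b = of_real (R\<^sup>2)" using complex_norm_square[of b] by simp
    have "b \<noteq> 0" using z0 \<open>norm b = R\<close> assms(4) by auto
    hence cb: "cnj b = of_real (R\<^sup>2) * inverse b" using bb by (simp add: field_simps)
    have "d (Suc i) = norm (u - b)"
      using assms(5)[of "Suc i"] i by (simp add: A dist_norm u_def b_def algebra_simps)
    hence "of_real ((d (Suc i))\<^sup>2) = (u - b) * cnj (u - b)"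
      using complex_norm_square[of "u - b"] by simp
    also have "\<dots> = u * cnj u + b * cnj b - cnj u * b - u * cnj b" by (simp add: algebra_simps)
    also have "\<dots> = p * b + q * inverse b + S"
      unfolding uu bb unfolding cb by (simp add: p_def q_def S_def)
    finally show ?thesis by (simp add: b_def)
  qed
  have pq: "p * q = of_real (R\<^sup>2 * L\<^sup>2)" using uu by (simp add: p_def q_def mult_ac)
  \<comment> \<open>The power sum is evaluated in the complex numbers; injectivity of
    \<open>of_real\<close> brings the result back to the reals.\<close>
  have "complex_of_real (\<Sum>i=1..n. d i ^ (2 * m)) = (\<Sum>i<n. of_real ((d (Suc i))\<^sup>2) ^ m)"
    by (simp add: sum.atLeast1_atMost_eq power_mult)
  also have "\<dots> = (\<Sum>i<n. (p * (z * w ^ i) + q * inverse (z * w ^ i) + S) ^ m)"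
    by (rule sum.cong) (simp_all only: dist_sq lessThan_iff)
  also have "\<dots> = of_nat n * (\<Sum>k\<le>m div 2. of_nat (m choose (2 * k)) * of_nat ((2 * k) choose k) *
      (p * q) ^ k * S ^ (m - 2 * k))"
    by (rule sum_shifted_binomial_root_of_unity[OF w(2,3) z0]) (use assms(1,7) in auto)
  also have "\<dots> = of_real (real n * (\<Sum>k\<le>m div 2. real (m choose (2 * k)) * real ((2 * k) choose k) *
      R ^ (2 * k) * L ^ (2 * k) * (R\<^sup>2 + L\<^sup>2) ^ (m - 2 * k)))"
    unfolding pq S_def by (simp add: power_mult_distrib mult_ac flip: power_mult)
  finally have "(\<Sum>i=1..n. d i ^ (2 * m)) = real n * (\<Sum>k\<le>m div 2. real (m choose (2 * k)) *
      real ((2 * k) choose k) * R ^ (2 * k) * L ^ (2 * k) * (R\<^sup>2 + L\<^sup>2) ^ (m - 2 * k))"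
    by (simp only: of_real_eq_iff)
  \<comment> \<open>The term \<open>k = 0\<close> is the separate summand (R^2 + L^2)^m of the
    claim.\<close>
  also have "{..m div 2} = insert 0 {1..m div 2}" by auto
  finally show ?thesis by simp
qed

end
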